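(* Let $k\ge 1$, $n$, and $1\le s_1<s_2<\dots<s_k<\frac n2$ be integers such that the circulant graph $C_n(s_1,\dots,s_k)$ is connected (i.e. $\gcd(s_1,\dots,s_k,n)=1$). Let $\tau(n)$ be the number of spanning trees of $C_n(s_1,\dots,s_k)$. Then $$\tau(n)=(-1)^{(n-1)(s_k-1)}\,n\prod_{p=1}^{s_k-1}\frac{T_n(w_p)-1}{w_p-1},$$ where $w_1,\dots,w_{s_k-1}$ are the complex roots (counted with multiplicity) of the polynomial $$P(w)=\sum_{j=1}^k\frac{T_{s_j}(w)-1}{w-1},$$ which has degree $s_k-1$.
   Context: $C_n(s_1,\dots,s_k)$ is the graph with vertices $0,1,\dots,n-1$ in which each vertex $i$ is adjacent to the vertices $i\pm s_1,\dots,i\pm s_k \pmod n$. $T_m$ denotes the Chebyshev polynomial of the first kind, $T_m(\cos\varphi)=\cos(m\varphi)$. Each quotient $\frac{T_{s_j}(w)-1}{w-1}$ is a polynomial in $w$, since $T_{s_j}(1)=1$. An empty product equals $1$. *)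

theory Defs
  imports
    "HOL-Computational_Algebra.Computational_Algebra"
    "HOL-Number_Theory.Cong"
begin

text \<open>
  A simple undirected graph is given by a vertex set \<open>V\<close> and a set \<open>E\<close> of two-element subsets
  of \<open>V\<close>.
\<close>

definition graph_connected :: "'a set \<Rightarrow> 'a set set \<Rightarrow> bool" where
  "graph_connected V E \<longleftrightarrow>
     V \<noteq> {} \<and> (\<forall>u\<in>V. \<forall>v\<in>V. (u, v) \<in> {(x, y). {x, y} \<in> E}\<^sup>*)"

definition graph_cycle :: "'a set set \<Rightarrow> 'a list \<Rightarrow> bool" where
  "graph_cycle E xs \<longleftrightarrow>
     length xs \<ge> 3 \<and> distinct xs \<and>
     (\<forall>i<length xs. {xs ! i, xs ! (Suc i mod length xs)} \<in> E)"

definition is_tree :: "'a set \<Rightarrow> 'a set set \<Rightarrow> bool" where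
  "is_tree V E \<longleftrightarrow> graph_connected V E \<and> (\<nexists>xs. graph_cycle E xs)"

definition spanning_trees :: "'a set \<Rightarrow> 'a set set \<Rightarrow> 'a set set set" where
  "spanning_trees V E = {F. F \<subseteq> E \<and> is_tree V F}"

text \<open>
  The jumps \<open>s\<^sub>1, \<dots>, s\<^sub>k\<close> are the values of \<open>s\<close> on \<open>{1..k}\<close>; other values are irrelevant. If
  \<open>0 < s\<^sub>j < n\<close> for all \<open>j\<close> then all members of the following set have two elements.
\<close>

definition circulant_edges :: "nat \<Rightarrow> nat \<Rightarrow> (nat \<Rightarrow> nat) \<Rightarrow> nat set set" where
  "circulant_edges n k s =
     {{i, i'} | i i'. i < n \<and> i' < n \<and>
        (\<exists>j\<in>{1..k}. [int i' = int i + int (s j)] (mod int n) \<or>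
                    [int i' = int i - int (s j)] (mod int n))}"

fun chebyshev_T :: "nat \<Rightarrow> 'a::comm_ring_1 poly" where
  "chebyshev_T 0 = 1"
| "chebyshev_T (Suc 0) = [:0, 1:]"
| "chebyshev_T (Suc (Suc m)) = [:0, 2:] * chebyshev_T (Suc m) - chebyshev_T m"

text \<open>The next two lemmas show that the recurrence defines the usual polynomials.\<close>

lemma poly_chebyshev_T_cos:
  fixes x :: "'a::{real_normed_field, banach}"
  shows "poly (chebyshev_T m) (cos x) = cos (of_nat m * x)"
proof (induction m rule: chebyshev_T.induct)
  case (3 m)
  have "cos (of_nat (Suc (Suc m)) * x) + cos (of_nat m * x)
      = cos (of_nat (Suc m) * x + x) + cos (of_nat (Suc m) * x - x)"
    by (simp add: algebra_simps)
  also have "\<dots> = 2 * cos x * cos (of_nat (Suc m) * x)"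
    unfolding cos_add cos_diff by simp
  finally show ?case
    using 3 by (simp add: algebra_simps)
qed auto

lemma chebyshev_T_unique:
  fixes p :: "complex poly"
  assumes "\<And>x::real. poly p (of_real (cos x)) = of_real (cos (of_nat m * x))"
  shows "p = chebyshev_T m"
proof -
  have "poly (p - chebyshev_T m) z = 0" if z: "z \<in> complex_of_real ` {-1..1}" for z
  proof -
    from z obtain y where y: "z = of_real y" "-1 \<le> y" "y \<le> 1"
      by auto
    have "cos (arccos y) = y"
      using y by (intro cos_arccos) auto
    then have "z = cos (of_real (arccos y))"
      using y by (simp only: cos_of_real)
    moreover have "z = of_real (cos (arccos y))"
      using y by (simp only: \<open>cos (arccos y) = y\<close>)
    ultimately have "poly (chebyshev_T m) z = of_real (cos (of_nat m * arccos y))"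
      by (metis cos_of_real of_real_mult of_real_of_nat_eq poly_chebyshev_T_cos)
    with assms[of "arccos y"] y \<open>cos (arccos y) = y\<close> show ?thesis
      by simp
  qed
  then have "complex_of_real ` {-1..1} \<subseteq> {z. poly (p - chebyshev_T m) z = 0}"
    by blast
  moreover have "infinite (complex_of_real ` {-1..1})"
    by (subst finite_image_iff) (auto simp: inj_on_def infinite_Icc_iff)
  ultimately have "p - chebyshev_T m = 0"
    using poly_roots_finite finite_subset by blast
  then show ?thesis
    by simp
qed

text \<open>
  In the following polynomial division the remainder is \<open>0\<close>, see \<open>chebyshev_quot_mult\<close> below.
\<close>

definition chebyshev_quot :: "nat \<Rightarrow> complex poly" where
  "chebyshev_quot m = (chebyshev_T m - 1) div [:-1, 1:]"

definition circulant_poly :: "nat \<Rightarrow> (nat \<Rightarrow> nat) \<Rightarrow> complex poly" where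
  "circulant_poly k s = (\<Sum>j=1..k. chebyshev_quot (s j))"

lemma poly_chebyshev_T_1 [simp]: "poly (chebyshev_T m) 1 = 1"
  by (induction m rule: chebyshev_T.induct) auto

lemma chebyshev_quot_mult: "chebyshev_quot m * [:-1, 1:] = chebyshev_T m - 1"
proof -
  have "[:-1, 1:] dvd (chebyshev_T m - 1 :: complex poly)"
    using poly_eq_0_iff_dvd[of "chebyshev_T m - 1 :: complex poly" 1] by simp
  then show ?thesis
    unfolding chebyshev_quot_def by (rule dvd_div_mult_self)
qed

text \<open>The roots of \<open>circulant_poly\<close> differ from \<open>1\<close>, so dividing by \<open>w - 1\<close> is harmless.\<close>

lemma poly_chebyshev_quot_1: "poly (chebyshev_quot m) 1 = of_nat (m\<^sup>2)"
proof (induction m rule: chebyshev_T.induct)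
  case 1
  show ?case by (simp add: chebyshev_quot_def)
next
  case 2
  have "chebyshev_quot (Suc 0) = 1"
    by (simp add: chebyshev_quot_def one_pCons del: One_nat_def)
  then show ?case by simp
next
  case (3 m)
  have "chebyshev_quot (Suc (Suc m)) * [:-1, 1:]
      = ([:0, 2:] * chebyshev_quot (Suc m) - chebyshev_quot m + 2) * [:-1, 1:]"
    unfolding ring_distribs mult.assoc chebyshev_quot_mult
    by (simp add: algebra_simps one_pCons numeral_poly)
  then have "chebyshev_quot (Suc (Suc m))
      = [:0, 2:] * chebyshev_quot (Suc m) - chebyshev_quot m + 2"
    by (subst (asm) mult_cancel_right) simp
  then have "poly (chebyshev_quot (Suc (Suc m))) 1
      = 2 * poly (chebyshev_quot (Suc m)) 1 - poly (chebyshev_quot m) 1 + 2"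
    by simp
  with 3 show ?case
    by (simp add: power2_eq_square algebra_simps)
qed

lemma poly_circulant_poly_1_neq_0:
  assumes "j \<in> {1..k}" and "s j \<ge> 1"
  shows "poly (circulant_poly k s) 1 \<noteq> 0"
proof -
  have "poly (circulant_poly k s) 1 = of_nat (\<Sum>j=1..k. (s j)\<^sup>2)"
    by (simp add: circulant_poly_def poly_sum poly_chebyshev_quot_1)
  moreover have "(\<Sum>j=1..k. (s j)\<^sup>2) > 0"
    using assms by (intro sum_pos2[of _ j]) auto
  ultimately show ?thesis
    by (simp only: of_nat_eq_0_iff)
qed

end

theory Submission
  imports Defs "Jordan_Normal_Form.Determinant"
begin

text \<open>
  By Kirchhoff's theorem, the number \<open>\<tau>\<close> of spanning trees satisfies
  \<open>n \<tau> = \<lambda>\<^sub>1 \<cdots> \<lambda>\<^sub>n\<^sub>-\<^sub>1\<close>, where the \<open>\<lambda>\<^sub>j\<close> are the eigenvalues of the Laplacian other than that of the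
  constant vector. The Laplacian of a circulant graph is diagonalized by the discrete Fourier
  transform, and with \<open>c\<^sub>j = cos (2 \<pi> j / n)\<close> its eigenvalues are
  \<open>\<lambda>\<^sub>j = \<Sum>\<^sub>i (2 - 2 T\<^sub>s\<^sub>i(c\<^sub>j)) = 2 (1 - c\<^sub>j) P(c\<^sub>j)\<close>. The numbers \<open>c\<^sub>1, \<dots>, c\<^sub>n\<^sub>-\<^sub>1\<close> are the roots, with
  multiplicity, of \<open>Q(w) = (T\<^sub>n(w) - 1) / (w - 1)\<close>, whose leading coefficient is \<open>2\<^sup>n\<^sup>-\<^sup>1\<close>. Hence the
  factors \<open>2 (1 - c\<^sub>j)\<close> multiply to \<open>Q(1) = n\<^sup>2\<close>, and \<open>\<Prod>\<^sub>j P(c\<^sub>j)\<close> is the resultant of \<open>P\<close> and \<open>Q\<close> up to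
  normalization, which can be evaluated as a product of values of \<open>Q\<close> at the roots of \<open>P\<close>.

  For Kirchhoff's theorem (\<open>matrix_tree\<close>) a proof by counting functions is given. A spanning tree is
  the same as a map that assigns a parent to every vertex but the root, such that the root is
  reached from everywhere (\<open>bij_betw_parent_maps_spanning_trees\<close>). Expanding the determinant of the
  Laplacian with one row replaced by a unit vector, multilinearly in the rows, gives one summand for
  every choice of neighbours, and this summand is \<open>1\<close> for parent maps and \<open>0\<close> otherwise
  (\<open>det_parent_matrix_rooted\<close>, \<open>det_parent_matrix_not_rooted\<close>). The passage to eigenvalues uses
  \<open>det (L + J) = n\<^sup>2 \<tau>\<close> for the all-ones matrix \<open>J\<close> (\<open>matrix_tree_plus_ones\<close>), because \<open>L + J\<close> is again
  diagonal in the Fourier basis (\<open>spanning_trees_circulant\<close>). The Chebyshev side rests on the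
  factorization of \<open>T\<^sub>n - 1\<close> (\<open>chebyshev_T_minus_1_factorization\<close>) and on the evaluation of the
  resultant (\<open>prod_poly_node\<close>).
\<close>

section \<open>Spanning trees as parent maps\<close>

definition neighbours :: "'a set set \<Rightarrow> 'a \<Rightarrow> 'a set" where
  "neighbours E v = {u. {v, u} \<in> E}"

definition simple_graph :: "'a set \<Rightarrow> 'a set set \<Rightarrow> bool" where
  "simple_graph V E \<longleftrightarrow> finite V \<and> (\<forall>e\<in>E. \<exists>u\<in>V. \<exists>v\<in>V. u \<noteq> v \<and> e = {u, v})"

text \<open>
  A rooted tree is recorded by the map that sends every vertex to its parent. The root is sent to
  itself, so that \<open>f\<close> can be iterated, and every vertex reaches the root under iteration.
\<close>

definition parent_choices :: "'a \<Rightarrow> 'a set set \<Rightarrow> 'a \<Rightarrow> 'a set" where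
  "parent_choices r E v = (if v = r then {r} else neighbours E v)"

definition rooted :: "'a \<Rightarrow> 'a set \<Rightarrow> ('a \<Rightarrow> 'a) \<Rightarrow> bool" where
  "rooted r V f \<longleftrightarrow> (\<forall>v\<in>V. \<exists>m. (f ^^ m) v = r)"

definition depth :: "'a \<Rightarrow> ('a \<Rightarrow> 'a) \<Rightarrow> 'a \<Rightarrow> nat" where
  "depth r f v = (LEAST m. (f ^^ m) v = r)"

definition parent_maps :: "'a \<Rightarrow> 'a set \<Rightarrow> 'a set set \<Rightarrow> ('a \<Rightarrow> 'a) set" where
  "parent_maps r V E = {f \<in> PiE V (parent_choices r E). rooted r V f}"

definition parent_edges :: "'a \<Rightarrow> 'a set \<Rightarrow> ('a \<Rightarrow> 'a) \<Rightarrow> 'a set set" where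
  "parent_edges r V f = (\<lambda>v. {v, f v}) ` (V - {r})"

lemma depth_parent:
  assumes "rooted r V f" "v \<in> V" "v \<noteq> r"
  shows "depth r f v = Suc (depth r f (f v))"
proof -
  obtain m where "(f ^^ m) v = r"
    using assms by (auto simp: rooted_def)
  then have "(LEAST m. (f ^^ m) v = r) = Suc (LEAST m. (f ^^ Suc m) v = r)"
    by (rule Least_Suc) (use assms in auto)
  then show ?thesis
    by (simp add: depth_def funpow_Suc_right del: funpow.simps)
qed

lemma neighbours_subset:
  assumes "simple_graph V E"
  shows "neighbours E v \<subseteq> V - {v}"
  using assms unfolding simple_graph_def neighbours_def
  by (auto simp: doubleton_eq_iff)

lemma parent_maps_parent:
  assumes "f \<in> parent_maps r V E" "v \<in> V" "v \<noteq> r"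
  shows "{v, f v} \<in> E" "depth r f v = Suc (depth r f (f v))"
  using assms depth_parent[of r V f v]
  by (auto simp: parent_maps_def parent_choices_def neighbours_def PiE_iff split: if_splits dest!: bspec[of V _ v])

lemma parent_edges_connected:
  assumes "rooted r V f" "r \<in> V" "f ` V \<subseteq> V"
  shows "graph_connected V (parent_edges r V f)"
proof -
  define R where "R = {(x, y). {x, y} \<in> parent_edges r V f}"
  have to_root: "v \<in> V \<Longrightarrow> (v, r) \<in> R\<^sup>*" for v
  proof (induction "depth r f v" arbitrary: v rule: less_induct)
    case less
    show ?case
    proof (cases "v = r")
      case False
      with less.prems have "(v, f v) \<in> R"
        by (auto simp: R_def parent_edges_def)
      moreover have "(f v, r) \<in> R\<^sup>*"
        using less False assms(3) depth_parent[OF assms(1), of v] by auto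
      ultimately show ?thesis
        by (rule converse_rtrancl_into_rtrancl)
    qed simp
  qed
  have "sym R"
    by (auto simp: R_def sym_def insert_commute)
  then have "(r, v) \<in> R\<^sup>*" if "v \<in> V" for v
    using to_root[OF that] by (meson sym_rtrancl symD)
  with to_root show ?thesis
    unfolding graph_connected_def R_def[symmetric] using assms(2) by (meson empty_iff rtrancl_trans)
qed

lemma cycle_two_neighbours:
  assumes "graph_cycle E xs" "x \<in> set xs"
  obtains y z where "y \<in> set xs" "z \<in> set xs" "y \<noteq> z" "{x, y} \<in> E" "{x, z} \<in> E"
proof -
  define l where "l = length xs"
  have l: "l \<ge> 3" and dist: "distinct xs"
    and E: "\<And>i. i < l \<Longrightarrow> {xs ! i, xs ! (Suc i mod l)} \<in> E"
    using assms(1) by (auto simp: graph_cycle_def l_def)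
  obtain i where i: "i < l" "x = xs ! i"
    using assms(2) by (auto simp: in_set_conv_nth l_def)
  define a where "a = Suc i mod l"
  define b where "b = (if i = 0 then l - 1 else i - 1)"
  have a: "a < l" and b: "b < l" and sb: "Suc b mod l = i"
    using l i by (auto simp: a_def b_def)
  have "a \<noteq> b"
    using l i by (cases "Suc i = l") (auto simp: a_def b_def)
  then have "xs ! a \<noteq> xs ! b"
    using dist a b by (simp add: nth_eq_iff_index_eq l_def)
  moreover have "{x, xs ! a} \<in> E"
    using E[OF i(1)] by (simp add: i a_def)
  moreover have "{x, xs ! b} \<in> E"
    using E[OF b] by (simp add: i sb insert_commute)
  ultimately show ?thesis
    using that[of "xs ! a" "xs ! b"] a b by (simp add: l_def)
qed

text \<open>
  On a cycle of edges \<open>{v, f v}\<close>, a vertex of maximal depth would have both of its neighbours on the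
  cycle as parents, since an edge from a child comes from greater depth.
\<close>

lemma parent_edges_acyclic:
  assumes "rooted r V f"
  shows "\<not> graph_cycle (parent_edges r V f) xs"
proof
  assume c: "graph_cycle (parent_edges r V f) xs"
  then have "set xs \<noteq> {}"
    by (auto simp: graph_cycle_def)
  then have "Max (depth r f ` set xs) \<in> depth r f ` set xs"
    by (intro Max_in) auto
  then obtain x where x: "x \<in> set xs" "depth r f x = Max (depth r f ` set xs)"
    by force
  then have max: "depth r f y \<le> depth r f x" if "y \<in> set xs" for y
    using that by simp
  have only: "y = f x" if "y \<in> set xs" "{x, y} \<in> parent_edges r V f" for y
  proof -
    from that(2) obtain v where v: "v \<in> V" "v \<noteq> r" "{x, y} = {v, f v}"
      by (auto simp: parent_edges_def)
    with depth_parent[OF assms v(1,2)] max[OF that(1)] show ?thesis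
      by (auto simp: doubleton_eq_iff)
  qed
  from cycle_two_neighbours[OF c x(1)] only show False
    by metis
qed

text \<open>
  Take a vertex \<open>v\<close> of least \<open>f\<close>-depth at which the two maps differ. The edge \<open>{v, f v}\<close> must then be
  the edge that \<open>g\<close> assigns to \<open>f v\<close>, so \<open>g\<close> sends \<open>f v\<close> down to \<open>v\<close> while \<open>f\<close> sends it up: the maps
  already differ at \<open>f v\<close>, which has smaller depth.
\<close>

lemma parent_edges_inj:
  assumes "f \<in> parent_maps r V E" "g \<in> parent_maps r V E'"
    and eq: "parent_edges r V f = parent_edges r V g" and "f ` V \<subseteq> V"
  shows "f = g"
proof (rule ccontr)
  assume "f \<noteq> g"
  note f = parent_maps_parent[OF assms(1)]
  have "f \<in> extensional V" "g \<in> extensional V"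
    using assms by (auto simp: parent_maps_def PiE_def)
  with \<open>f \<noteq> g\<close> obtain v0 where v0: "v0 \<in> V" "f v0 \<noteq> g v0"
    using extensionalityI by blast
  have False if "v \<in> V" "f v \<noteq> g v" for v
    using that
  proof (induction "depth r f v" arbitrary: v rule: less_induct)
    case less
    have "v \<noteq> r"
      using less.prems assms(1,2)
      by (auto simp: parent_maps_def parent_choices_def PiE_iff dest!: bspec[of V _ v])
    then have "{v, f v} \<in> parent_edges r V g"
      unfolding eq[symmetric] using less.prems by (auto simp: parent_edges_def)
    then obtain u where u: "u \<in> V" "u \<noteq> r" "{v, f v} = {u, g u}"
      by (auto simp: parent_edges_def)
    with less.prems have u': "u = f v" "g u = v"
      by (auto simp: doubleton_eq_iff)
    have d: "depth r f v = Suc (depth r f u)" "depth r f u = Suc (depth r f (f u))"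
      using f(2)[of v] f(2)[of u] u u' less.prems \<open>v \<noteq> r\<close> by auto
    then have "f u \<noteq> g u"
      using u' by auto
    with less.hyps[of u] d u(1) show False
      by simp
  qed
  from this[OF v0] show False .
qed

lemma simple_path_exists:
  assumes "(a, b) \<in> R\<^sup>*"
  shows "\<exists>xs. xs \<noteq> [] \<and> hd xs = a \<and> last xs = b \<and> distinct xs \<and>
    (\<forall>i. Suc i < length xs \<longrightarrow> (xs ! i, xs ! Suc i) \<in> R)"
  using assms
proof (induction rule: rtrancl_induct)
  case base
  show ?case
    by (rule exI[of _ "[a]"]) auto
next
  case (step y z)
  then obtain xs where xs: "xs \<noteq> []" "hd xs = a" "last xs = y" "distinct xs"
    "\<And>i. Suc i < length xs \<Longrightarrow> (xs ! i, xs ! Suc i) \<in> R"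
    by blast
  show ?case
  proof (cases "z \<in> set xs")
    case True
    \<comment> \<open>the walk returns to a vertex of the path: cut the path off there\<close>
    then obtain k where k: "k < length xs" "xs ! k = z"
      by (auto simp: in_set_conv_nth)
    show ?thesis
      by (rule exI[of _ "take (Suc k) xs"])
         (use xs k in \<open>auto simp: hd_take take_Suc_conv_app_nth[of k, THEN arg_cong[of _ _ last]]\<close>)
  next
    case False
    have "(xs ! i, z) \<in> R" if "Suc i = length xs" for i
    proof -
      have "i = length xs - 1"
        using that by simp
      then show ?thesis
        using xs step by (simp add: last_conv_nth)
    qed
    then show ?thesis
      by (intro exI[of _ "xs @ [z]"])
         (use xs False in \<open>auto simp: nth_append last_conv_nth less_Suc_eq\<close>)
  qed
qed

text \<open>
  An edge that joins two vertices of a connected graph closes a simple path between them. The path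
  has at least three vertices because the edge itself does not belong to the graph.
\<close>

lemma cycle_from_extra_edge:
  assumes F: "graph_connected V F" "F \<subseteq> E" and ab: "a \<in> V" "b \<in> V" "a \<noteq> b" "{a, b} \<in> E" "{a, b} \<notin> F"
  shows "\<exists>xs. graph_cycle E xs"
proof -
  from F ab have "(a, b) \<in> {(x, y). {x, y} \<in> F}\<^sup>*"
    by (auto simp: graph_connected_def)
  from simple_path_exists[OF this] obtain xs where
    xs: "xs \<noteq> []" "hd xs = a" "last xs = b" "distinct xs"
    "\<And>i. Suc i < length xs \<Longrightarrow> {xs ! i, xs ! Suc i} \<in> F"
    by auto
  define l where "l = length xs"
  have ends: "xs ! 0 = a" "xs ! (l - 1) = b"
    using xs by (auto simp: hd_conv_nth last_conv_nth l_def)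
  have "l \<noteq> 0" "l \<noteq> 1" 
    using xs ends ab by (auto simp: l_def)
  moreover have "l \<noteq> 2"
    using xs(5)[of 0] ends ab by (auto simp: l_def)
  ultimately have l: "l \<ge> 3"
    by simp
  have "{xs ! i, xs ! (Suc i mod l)} \<in> E" if "i < l" for i
  proof (cases "Suc i = l")
    case True
    then have "i = l - 1" by simp
    then show ?thesis
      using True ends ab by (simp add: insert_commute)
  next
    case False
    then show ?thesis
      using xs(5)[of i] that F by (auto simp: l_def)
  qed
  with l xs(4) show ?thesis
    by (auto simp: graph_cycle_def l_def)
qed

text \<open>
  Breadth-first search: any neighbour that is closer to the root can serve as the parent.
\<close>

lemma connected_has_parent_map:
  assumes "graph_connected V F" "simple_graph V F" "r \<in> V"
  shows "parent_maps r V F \<noteq> {}"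
proof -
  define R where "R = {(x, y). {x, y} \<in> F}"
  define d where "d v = (LEAST m. (v, r) \<in> R ^^ m)" for v
  have closer: "\<exists>u. {v, u} \<in> F \<and> d u < d v" if v: "v \<in> V" "v \<noteq> r" for v
  proof -
    have "(v, r) \<in> R\<^sup>*"
      using assms v by (auto simp: graph_connected_def R_def)
    then have dv: "(v, r) \<in> R ^^ d v"
      unfolding d_def by (metis LeastI rtrancl_imp_relpow)
    obtain m where m: "d v = Suc m"
      using dv v by (cases "d v") auto
    with dv obtain u where u: "(v, u) \<in> R" "(u, r) \<in> R ^^ m"
      by (metis relpow_Suc_D2)
    then have "d u \<le> m"
      unfolding d_def by (intro Least_le)
    with m u show ?thesis
      by (auto simp: R_def)
  qed
  define f where "f = restrict (\<lambda>v. if v = r then r else (SOME u. {v, u} \<in> F \<and> d u < d v)) V"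
  have f: "{v, f v} \<in> F \<and> d (f v) < d v" if "v \<in> V" "v \<noteq> r" for v
    using someI_ex[OF closer[OF that]] that by (simp add: f_def)
  have fr: "f r = r"
    using assms(3) by (simp add: f_def)
  have fV: "f v \<in> V" if "v \<in> V" for v
    using f[OF that] neighbours_subset[OF assms(2), of v] assms(3) fr
    by (cases "v = r") (auto simp: neighbours_def)
  have "\<exists>m. (f ^^ m) v = r" if "v \<in> V" for v
    using that
  proof (induction "d v" arbitrary: v rule: less_induct)
    case less
    show ?case
    proof (cases "v = r")
      case True
      then show ?thesis by (intro exI[of _ 0]) simp
    next
      case False
      with less f[of v] fV[of v] obtain m where "(f ^^ m) (f v) = r"
        by blast
      then have "(f ^^ Suc m) v = r"
        by (simp add: funpow_Suc_right del: funpow.simps)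
      then show ?thesis ..
    qed
  qed
  then have "f \<in> parent_maps r V F"
    using f fr by (auto simp: parent_maps_def rooted_def parent_choices_def neighbours_def f_def)
  then show ?thesis
    by blast
qed

text \<open>
  A spanning tree is determined by its parent map, so trees can be counted by counting functions.
  Every tree \<open>F\<close> arises: the edges of a parent map inside \<open>F\<close> are already connected, and one more
  edge of \<open>F\<close> would create a cycle.
\<close>

theorem bij_betw_parent_maps_spanning_trees:
  assumes "simple_graph V E" "r \<in> V"
  shows "bij_betw (parent_edges r V) (parent_maps r V E) (spanning_trees V E)"
proof -
  have maps: "f ` V \<subseteq> V" "rooted r V f" if "f \<in> parent_maps r V F" "F \<subseteq> E" for f F
  proof -
    have "neighbours F v \<subseteq> V" for v
      using neighbours_subset[OF assms(1), of v] \<open>F \<subseteq> E\<close> by (auto simp: neighbours_def)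
    then show "f ` V \<subseteq> V" "rooted r V f"
      using that assms(2) by (fastforce simp: parent_maps_def parent_choices_def PiE_iff split: if_splits)+
  qed
  have sub: "parent_edges r V f \<subseteq> F" if "f \<in> parent_maps r V F" for f F
    using parent_maps_parent[OF that] by (auto simp: parent_edges_def)
  have "parent_edges r V f \<in> spanning_trees V E" if "f \<in> parent_maps r V E" for f
    using maps[OF that] sub[OF that] parent_edges_connected[of r V f]
      parent_edges_acyclic[OF maps(2)[OF that]] assms
    by (auto simp: spanning_trees_def is_tree_def)
  moreover have "F \<in> parent_edges r V ` parent_maps r V E" if "F \<in> spanning_trees V E" for F
  proof -
    have F: "F \<subseteq> E" "graph_connected V F" "\<And>xs. \<not> graph_cycle F xs"
      using that by (auto simp: spanning_trees_def is_tree_def)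
    then have simple: "simple_graph V F"
      using assms(1) by (auto simp: simple_graph_def)
    then obtain f where f: "f \<in> parent_maps r V F"
      using connected_has_parent_map[OF F(2) simple assms(2)] by blast
    have "F \<subseteq> parent_edges r V f"
    proof
      fix e assume e: "e \<in> F"
      then obtain a b where ab: "a \<in> V" "b \<in> V" "a \<noteq> b" "e = {a, b}"
        using simple by (auto simp: simple_graph_def)
      with cycle_from_extra_edge[of V "parent_edges r V f" F a b] e F(3) sub[OF f]
        parent_edges_connected[of r V f] maps[OF f F(1)] assms(2)
      show "e \<in> parent_edges r V f"
        by blast
    qed
    with sub[OF f] have "F = parent_edges r V f"
      by blast
    moreover have "f \<in> parent_maps r V E"
      using f F(1) by (fastforce simp: parent_maps_def parent_choices_def neighbours_def PiE_iff split: if_splits)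
    ultimately show ?thesis
      by blast
  qed
  moreover have "inj_on (parent_edges r V) (parent_maps r V E)"
    by (intro inj_onI) (rule parent_edges_inj[OF _ _ _ maps(1)], auto)
  ultimately show ?thesis
    by (auto simp: bij_betw_def)
qed

section \<open>The matrix-tree theorem\<close>

text \<open>
  The matrix \<open>I - A\<close> for the adjacency matrix \<open>A\<close> of the arrows \<open>v \<rightarrow> f v\<close>, where the loop at the root
  is left out.
\<close>

definition parent_matrix :: "nat \<Rightarrow> nat \<Rightarrow> (nat \<Rightarrow> nat) \<Rightarrow> 'a::comm_ring_1 mat" where
  "parent_matrix n r f =
     mat n n (\<lambda>(v, u). if v = r then of_bool (u = r) else of_bool (u = v) - of_bool (u = f v))"

lemma parent_matrix_carrier [simp]: "parent_matrix n r f \<in> carrier_mat n n"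
  by (simp add: parent_matrix_def)

text \<open>
  The matrix is triangular up to ordering the vertices by depth. Ordering is avoided as follows: if
  the term of a permutation \<open>p\<close> in the Leibniz formula does not vanish, then \<open>p\<close> never increases the
  depth, and as it preserves the sum of all depths it preserves each of them, which forces
  \<open>p v = v\<close> rather than \<open>p v = f v\<close>.
\<close>

lemma det_parent_matrix_rooted:
  assumes "rooted r {0..<n} f"
  shows "det (parent_matrix n r f :: 'a::idom mat) = 1"
proof -
  define A :: "'a mat" where "A = parent_matrix n r f"
  have depth: "depth r f v = Suc (depth r f (f v))" if "v < n" "v \<noteq> r" for v
    using depth_parent[OF assms] that by simp
  have zero: "(\<Prod>v = 0..<n. A $$ (v, p v)) = 0" if p: "p permutes {0..<n}" "p \<noteq> id" for p
  proof (rule ccontr)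
    assume "(\<Prod>v = 0..<n. A $$ (v, p v)) \<noteq> 0"
    then have nz: "A $$ (v, p v) \<noteq> 0" if "v < n" for v
      using that by auto
    have p_or: "p v = v \<or> v \<noteq> r \<and> p v = f v" if "v < n" for v
    proof -
      have "p v < n"
        using permutes_in_image[OF p(1), of v] that by simp
      with nz[OF that] that show ?thesis
        by (auto simp: A_def parent_matrix_def split: if_splits)
    qed
    have "(\<Sum>v\<in>{0..<n}. depth r f (p v)) = (\<Sum>v\<in>{0..<n}. depth r f v)"
      by (rule sum.permute[OF p(1), unfolded o_def, symmetric])
    moreover have "depth r f (p v) \<le> depth r f v" if "v \<in> {0..<n}" for v
      using p_or[of v] depth[of v] that by auto
    ultimately have same: "depth r f (p v) = depth r f v" if "v < n" for v
      using sum_mono_inv[of "\<lambda>v. depth r f (p v)" "{0..<n}" "depth r f" v] that by auto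
    have "p v = v" for v
    proof (cases "v < n")
      case True
      then show ?thesis
        using same[OF True] p_or[OF True] depth[of v] by auto
    next
      case False
      then show ?thesis
        using p(1) by (simp add: permutes_def)
    qed
    with p(2) show False
      by auto
  qed
  have diag: "A $$ (v, v) = 1" if "v < n" for v
    using that depth[of v] by (auto simp: A_def parent_matrix_def)
  have "det A = (\<Sum>p | p permutes {0..<n}. signof p * (\<Prod>v = 0..<n. A $$ (v, p v)))"
    by (rule det_def') (simp add: A_def)
  also have "\<dots> = (\<Sum>p\<in>{id}. signof p * (\<Prod>v = 0..<n. A $$ (v, p v)))"
    by (rule sum.mono_neutral_right) (auto simp: zero finite_permutations permutes_id)
  also have "\<dots> = 1"
    using diag by simp
  finally show ?thesis
    by (simp add: A_def)
qed

text \<open>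
  The indicator function of the vertices that never reach the root is constant along each arrow and
  vanishes at the root, hence it lies in the kernel.
\<close>

lemma det_parent_matrix_not_rooted:
  assumes "\<not> rooted r {0..<n} f" "f ` {0..<n} \<subseteq> {0..<n}"
  shows "det (parent_matrix n r f :: 'a::idom mat) = 0"
proof -
  define A :: "'a mat" where "A = parent_matrix n r f"
  define stray where "stray v \<longleftrightarrow> (\<forall>m. (f ^^ m) v \<noteq> r)" for v
  define x :: "'a vec" where "x = vec n (\<lambda>v. of_bool (stray v))"
  have stray_step: "stray (f v) \<longleftrightarrow> stray v" if "v \<noteq> r" for v
  proof -
    have "(\<exists>m. (f ^^ m) v = r) \<longleftrightarrow> (\<exists>m. (f ^^ Suc m) v = r)"
      using that by (metis funpow_0 not0_implies_Suc)
    then show ?thesis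
      by (auto simp: stray_def funpow_Suc_right simp del: funpow.simps)
  qed
  have stray_r: "\<not> stray r"
    unfolding stray_def by (metis funpow_0)
  obtain v0 where "v0 < n" "stray v0"
    using assms(1) by (auto simp: rooted_def stray_def)
  then have "x $ v0 \<noteq> 0\<^sub>v n $ v0"
    by (simp add: x_def)
  then have "x \<noteq> 0\<^sub>v n"
    by metis
  moreover have "A *\<^sub>v x = 0\<^sub>v n"
  proof (rule eq_vecI)
    fix v assume "v < dim_vec (0\<^sub>v n :: 'a vec)"
    then have v: "v < n" by simp
    then have fv: "f v < n"
      using assms(2) by (auto simp: image_subset_iff)
    have "(A *\<^sub>v x) $ v = (\<Sum>u = 0..<n. A $$ (v, u) * of_bool (stray u))"
      using v by (simp add: A_def x_def scalar_prod_def parent_matrix_def)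
    also have "\<dots> = 0"
    proof (cases "v = r")
      case True
      have "(\<Sum>u = 0..<n. A $$ (v, u) * of_bool (stray u)) = (\<Sum>u = 0..<n. 0 :: 'a)"
        by (rule sum.cong) (use True v stray_r in \<open>auto simp: A_def parent_matrix_def\<close>)
      then show ?thesis by simp
    next
      case False
      have "(\<Sum>u = 0..<n. A $$ (v, u) * of_bool (stray u))
          = (\<Sum>u = 0..<n. if u = v then of_bool (stray u) else 0)
            - (\<Sum>u = 0..<n. if u = f v then of_bool (stray u) else 0)"
        unfolding sum_subtractf[symmetric]
        by (rule sum.cong) (use False v in \<open>auto simp: A_def parent_matrix_def\<close>)
      also have "\<dots> = of_bool (stray v) - of_bool (stray (f v))"
        using v fv by simp
      finally show ?thesis
        using stray_step[OF False] by simp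
    qed
    finally show "(A *\<^sub>v x) $ v = 0\<^sub>v n $ v"
      using v by simp
  qed (simp add: A_def parent_matrix_def)
  ultimately show ?thesis
    using det_0_iff_vec_prod_zero[of A n] by (auto simp: A_def x_def intro: exI[of _ x])
qed

definition laplacian :: "nat \<Rightarrow> nat set set \<Rightarrow> 'a::comm_ring_1 mat" where
  "laplacian n E =
     mat n n (\<lambda>(v, u). if u = v then of_nat (card (neighbours E v)) else - of_bool ({v, u} \<in> E))"

text \<open>
  Replacing row \<open>r\<close> by the unit vector \<open>e\<^sub>r\<close> has the same effect on the determinant as deleting row
  and column \<open>r\<close>, but keeps the indices of the other vertices.
\<close>

definition grounded :: "nat \<Rightarrow> 'a::comm_ring_1 mat \<Rightarrow> 'a mat" where
  "grounded r A = mat (dim_row A) (dim_col A)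
     (\<lambda>(v, u). if v = r then of_bool (u = r) else A $$ (v, u))"

lemma laplacian_carrier [simp]: "laplacian n E \<in> carrier_mat n n"
  by (simp add: laplacian_def)

lemma laplacian_dim [simp]: "dim_row (laplacian n E) = n" "dim_col (laplacian n E) = n"
  by (simp_all add: laplacian_def)

lemma laplacian_entry:
  assumes "simple_graph {0..<n} E" "v < n" "u < n"
  shows "(laplacian n E :: 'a::comm_ring_1 mat) $$ (v, u)
    = (\<Sum>w\<in>neighbours E v. of_bool (u = v) - of_bool (u = w))"
proof -
  have N: "neighbours E v \<subseteq> {0..<n} - {v}"
    using neighbours_subset[OF assms(1)] by simp
  then have fin: "finite (neighbours E v)"
    using finite_subset by blast
  have "(\<Sum>w\<in>neighbours E v. of_bool (u = w)) = (of_bool (u \<in> neighbours E v) :: 'a)"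
    using fin by (simp add: of_bool_def)
  moreover have "{v, u} \<in> E \<longleftrightarrow> u \<in> neighbours E v"
    by (simp add: neighbours_def)
  moreover have "v \<notin> neighbours E v"
    using N by auto
  ultimately show ?thesis
    using assms(2,3) by (cases "u = v") (simp_all add: laplacian_def sum_subtractf sum_negf)
qed

text \<open>
  Row \<open>v \<noteq> r\<close> of the Laplacian is the sum of \<open>e\<^sub>v - e\<^sub>w\<close> over the neighbours \<open>w\<close> of \<open>v\<close>, where \<open>e\<close>
  denotes unit vectors. By multilinearity in the rows the determinant is a sum over all ways to
  choose a neighbour \<open>f v\<close> for every \<open>v\<close>, and the summand is \<open>1\<close> or \<open>0\<close> according to whether \<open>f\<close> is
  a parent map.
\<close>

theorem matrix_tree:
  assumes "simple_graph {0..<n} E" "r < n"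
  shows "det (grounded r (laplacian n E) :: 'a::idom mat)
    = of_nat (card (spanning_trees {0..<n} E))"
proof -
  define V where "V = {0..<n}"
  define a :: "nat \<Rightarrow> nat \<Rightarrow> nat \<Rightarrow> 'a" where
    "a v w u = (if v = r then of_bool (u = r) else of_bool (u = v) - of_bool (u = w))" for v w u
  have N: "neighbours E v \<subseteq> V" for v
    using neighbours_subset[OF assms(1)] by (auto simp: V_def)
  have choices: "finite (parent_choices r E v)" "parent_choices r E v \<subseteq> V" for v
    using N[of v] finite_subset[OF N[of v]] assms(2)
    by (auto simp: parent_choices_def V_def)
  have entry: "grounded r (laplacian n E) $$ (v, p v) = (\<Sum>w\<in>parent_choices r E v. a v w (p v))"
    if "v \<in> V" "p permutes V" for v p
  proof -
    have v: "v < n" "p v < n"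
      using that permutes_in_image[OF that(2), of v] by (auto simp: V_def)
    show ?thesis
    proof (cases "v = r")
      case True
      then show ?thesis
        using v by (simp add: grounded_def parent_choices_def a_def)
    next
      case False
      then have "grounded r (laplacian n E) $$ (v, p v) = (laplacian n E $$ (v, p v) :: 'a)"
        using v by (simp add: grounded_def)
      also have "\<dots> = (\<Sum>w\<in>parent_choices r E v. a v w (p v))"
        unfolding laplacian_entry[OF assms(1) v] parent_choices_def a_def
        using False by (simp only: if_False)
      finally show ?thesis .
    qed
  qed
  have finite_PiE: "finite (PiE V (parent_choices r E))"
    using choices by (intro finite_PiE) (auto simp: V_def)
  have "det (grounded r (laplacian n E) :: 'a mat)
      = (\<Sum>p | p permutes V. signof p * (\<Prod>v\<in>V. grounded r (laplacian n E) $$ (v, p v)))"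
    unfolding V_def by (rule det_def') (simp add: grounded_def laplacian_def)
  also have "\<dots> = (\<Sum>p | p permutes V. signof p * (\<Prod>v\<in>V. \<Sum>w\<in>parent_choices r E v. a v w (p v)))"
    by (intro sum.cong refl arg_cong2[of _ _ _ _ "(*)"] prod.cong) (simp add: entry)
  also have "\<dots> = (\<Sum>p | p permutes V. signof p *
      (\<Sum>f\<in>PiE V (parent_choices r E). \<Prod>v\<in>V. a v (f v) (p v)))"
    by (subst prod_sum_PiE) (simp_all add: choices V_def)
  also have "\<dots> = (\<Sum>f\<in>PiE V (parent_choices r E). \<Sum>p | p permutes V.
      signof p * (\<Prod>v\<in>V. a v (f v) (p v)))"
    by (subst sum.swap) (simp add: sum_distrib_left)
  also have "\<dots> = (\<Sum>f\<in>PiE V (parent_choices r E). det (parent_matrix n r f))"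
  proof (rule sum.cong[OF refl])
    fix f
    have "det (parent_matrix n r f :: 'a mat)
        = (\<Sum>p | p permutes V. signof p * (\<Prod>v\<in>V. parent_matrix n r f $$ (v, p v)))"
      unfolding V_def by (rule det_def') simp
    also have "\<dots> = (\<Sum>p | p permutes V. signof p * (\<Prod>v\<in>V. a v (f v) (p v)))"
    proof (intro sum.cong refl arg_cong2[of _ _ _ _ "(*)"] prod.cong)
      fix p v assume "p \<in> {p. p permutes V}" "v \<in> V"
      then show "parent_matrix n r f $$ (v, p v) = a v (f v) (p v)"
        using permutes_in_image[of p V v] by (auto simp: V_def parent_matrix_def a_def)
    qed
    finally show "(\<Sum>p | p permutes V. signof p * (\<Prod>v\<in>V. a v (f v) (p v)))
        = det (parent_matrix n r f)" ..
  qed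
  also have "\<dots> = (\<Sum>f\<in>PiE V (parent_choices r E). of_bool (rooted r V f))"
  proof (rule sum.cong[OF refl])
    fix f assume "f \<in> PiE V (parent_choices r E)"
    then have "f ` V \<subseteq> V"
      using choices by (fastforce simp: PiE_iff)
    then show "det (parent_matrix n r f) = (of_bool (rooted r V f) :: 'a)"
      using det_parent_matrix_rooted det_parent_matrix_not_rooted by (cases "rooted r V f") (auto simp: V_def)
  qed
  also have "\<dots> = of_nat (card (parent_maps r V E))"
    using finite_PiE by (simp add: parent_maps_def Int_def)
  also have "card (parent_maps r V E) = card (spanning_trees V E)"
    using bij_betw_same_card[OF bij_betw_parent_maps_spanning_trees[OF assms(1), of r]] assms(2) by (simp add: V_def)
  finally show ?thesis
    by (simp add: V_def)
qed

section \<open>The Laplacian plus the all-ones matrix\<close>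

lemma det_triangular_unit:
  assumes "A \<in> carrier_mat n n" "upper_triangular A" "\<And>i. i < n \<Longrightarrow> A $$ (i, i) = 1"
  shows "det A = 1"
proof -
  have "det A = (\<Prod>i = 0..<n. A $$ (i, i))"
    using det_upper_triangular[OF assms(2,1)] assms(1) by (simp add: prod_list_diag_prod)
  then show ?thesis
    using assms(3) by simp
qed

lemma sum_of_bool_mult:
  fixes g :: "nat \<Rightarrow> 'a::comm_ring_1"
  assumes "i < n"
  shows "(\<Sum>u = 0..<n. of_bool (u = i) * g u) = g i" "(\<Sum>u = 0..<n. g u * of_bool (u = i)) = g i"
  using assms by (simp_all add: of_bool_def if_distrib if_distribR cong: if_cong)

text \<open>
  Adding the all-ones matrix \<open>J\<close> moves the eigenvalue \<open>0\<close> of the constant vector to \<open>n\<close> and leaves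
  the others alone, so \<open>det (L + J)\<close> compares the product of the nonzero eigenvalues with a
  principal minor. Elementary operations prove the identity: adding all rows to row \<open>0\<close> (matrix
  \<open>X\<close>), adding all columns to column \<open>0\<close> (matrix \<open>X\<^sup>T\<close>), and subtracting \<open>1 / n\<close> times
  column \<open>0\<close> from the other columns (matrix \<open>Y\<close>) turns row \<open>0\<close> into \<open>(n\<^sup>2, 0, \<dots>, 0)\<close> and
  restores \<open>L\<close> outside of row and column \<open>0\<close>.
\<close>

lemma det_plus_ones:
  fixes L :: "'a::field_char_0 mat"
  assumes L: "L \<in> carrier_mat n n" and "n > 0"
    and rows: "\<And>i. i < n \<Longrightarrow> (\<Sum>j = 0..<n. L $$ (i, j)) = 0"
    and cols: "\<And>j. j < n \<Longrightarrow> (\<Sum>i = 0..<n. L $$ (i, j)) = 0"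
  shows "det (mat n n (\<lambda>(i, j). L $$ (i, j) + 1)) = of_nat n ^ 2 * det (grounded 0 L)"
proof -
  define M where "M = mat n n (\<lambda>(i, j). L $$ (i, j) + 1)"
  define X :: "'a mat" where "X = mat n n (\<lambda>(i, j). of_bool (i = 0 \<or> j = i))"
  define Y :: "'a mat" where
    "Y = mat n n (\<lambda>(i, j). of_bool (i = j) - of_bool (i = 0 \<and> j \<noteq> 0) / of_nat n)"
  have carriers: "X \<in> carrier_mat n n" "M \<in> carrier_mat n n" "Y \<in> carrier_mat n n"
    "X * M \<in> carrier_mat n n" "X * M * transpose_mat X \<in> carrier_mat n n"
    by (auto simp: X_def M_def Y_def)
  have det_X: "det X = 1" and det_Y: "det Y = 1"
    by (rule det_triangular_unit[of _ n]; auto simp: X_def Y_def upper_triangular_def)+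
  define N where "N = X * M * transpose_mat X * Y"
  have XM: "(X * M) $$ (i, j) = (if i = 0 then of_nat n else L $$ (i, j) + 1)"
    if "i < n" "j < n" for i j
  proof -
    have "(X * M) $$ (i, j) = (\<Sum>u = 0..<n. of_bool (i = 0 \<or> u = i) * (L $$ (u, j) + 1))"
      using that by (simp add: X_def M_def scalar_prod_def)
    also have "\<dots> = (if i = 0 then of_nat n else L $$ (i, j) + 1)"
    proof (cases "i = 0")
      case True
      then show ?thesis
        using cols[OF that(2)] by (simp add: sum.distrib)
    next
      case False
      then show ?thesis
        using that(1) by (simp only: sum_of_bool_mult if_False simp_thms)
    qed
    finally show ?thesis .
  qed
  have XMX: "(X * M * transpose_mat X) $$ (i, j) =
      (if j = 0 then (if i = 0 then of_nat n ^ 2 else of_nat n)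
       else (if i = 0 then of_nat n else L $$ (i, j) + 1))"
    if "i < n" "j < n" for i j
  proof -
    have "(X * M * transpose_mat X) $$ (i, j)
        = (\<Sum>u = 0..<n. (X * M) $$ (i, u) * of_bool (j = 0 \<or> u = j))"
      using that by (simp add: X_def M_def scalar_prod_def)
    also have "\<dots> = (\<Sum>u = 0..<n. (if i = 0 then of_nat n else L $$ (i, u) + 1) * of_bool (j = 0 \<or> u = j))"
      by (rule sum.cong) (use that XM in auto)
    also have "\<dots> = (if j = 0 then (if i = 0 then of_nat n ^ 2 else of_nat n)
       else (if i = 0 then of_nat n else L $$ (i, j) + 1))"
    proof (cases "j = 0")
      case True
      then show ?thesis
        using rows[OF that(1)] by (simp add: sum.distrib power2_eq_square)
    next
      case False
      then show ?thesis
        using that(2) by (simp only: sum_of_bool_mult if_False simp_thms)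
    qed
    finally show ?thesis .
  qed
  have N: "N $$ (i, j) =
      (if j = 0 then (if i = 0 then of_nat n ^ 2 else of_nat n)
       else (if i = 0 then 0 else L $$ (i, j)))"
    if "i < n" "j < n" for i j
  proof -
    define B where "B = X * M * transpose_mat X"
    have B: "B \<in> carrier_mat n n"
      unfolding B_def by (rule carriers)
    have "N $$ (i, j) = (\<Sum>u = 0..<n. B $$ (i, u) * Y $$ (u, j))"
      using that carrier_matD[OF B] carrier_matD[OF carriers(3)]
      by (simp add: N_def B_def[symmetric] scalar_prod_def)
    also have "\<dots> = (\<Sum>u = 0..<n. B $$ (i, u) * of_bool (u = j))
        - (\<Sum>u = 0..<n. (B $$ (i, u) * of_bool (j \<noteq> 0) / of_nat n) * of_bool (u = 0))"
      unfolding sum_subtractf[symmetric]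
      by (rule sum.cong) (use that in \<open>auto simp: Y_def algebra_simps\<close>)
    also have "\<dots> = B $$ (i, j) - B $$ (i, 0) * of_bool (j \<noteq> 0) / of_nat n"
      using that \<open>n > 0\<close> by (simp only: sum_of_bool_mult)
    finally show ?thesis
      using that \<open>n > 0\<close> XMX[of i j] XMX[of i 0] by (auto simp: B_def power2_eq_square)
  qed
  have dimN: "N \<in> carrier_mat n n"
    unfolding N_def using carriers(5,3) by (rule mult_carrier_mat)
  have "det M = det N"
    using carriers det_transpose[OF carriers(1)]
    by (simp add: N_def det_mult[of _ n] det_X det_Y)
  also have "\<dots> = (\<Sum>j<n. N $$ (0, j) * cofactor N 0 j)"
    using \<open>n > 0\<close> by (rule laplace_expansion_row[OF dimN])
  also have "\<dots> = (\<Sum>j\<in>{0}. N $$ (0, j) * cofactor N 0 j)"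
    by (rule sum.mono_neutral_right) (use \<open>n > 0\<close> N in auto)
  also have "\<dots> = of_nat n ^ 2 * cofactor N 0 0"
    using N \<open>n > 0\<close> by simp
  also have "mat_delete N 0 0 = mat_delete (grounded 0 L) 0 0"
    using dimN L N by (intro eq_matI) (auto simp: mat_delete_def grounded_def)
  then have "cofactor N 0 0 = (\<Sum>j\<in>{0}. grounded 0 L $$ (0, j) * cofactor (grounded 0 L) 0 j)"
    using \<open>n > 0\<close> L by (simp add: cofactor_def grounded_def)
  also have "\<dots> = (\<Sum>j<n. grounded 0 L $$ (0, j) * cofactor (grounded 0 L) 0 j)"
    by (rule sum.mono_neutral_left) (use \<open>n > 0\<close> L in \<open>auto simp: grounded_def\<close>)
  also have "\<dots> = det (grounded 0 L)"
    by (rule laplace_expansion_row[symmetric]) (use \<open>n > 0\<close> L in \<open>auto simp: grounded_def\<close>)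
  finally show ?thesis
    by (simp add: M_def)
qed

lemma laplacian_mult_sum:
  fixes g :: "nat \<Rightarrow> 'a::comm_ring_1"
  assumes "simple_graph {0..<n} E" "v < n"
  shows "(\<Sum>u = 0..<n. laplacian n E $$ (v, u) * g u) = (\<Sum>w\<in>neighbours E v. g v - g w)"
proof -
  have "(\<Sum>u = 0..<n. laplacian n E $$ (v, u) * g u)
      = (\<Sum>u = 0..<n. \<Sum>w\<in>neighbours E v. of_bool (u = v) * g u - of_bool (u = w) * g u)"
    by (rule sum.cong)
       (use assms in \<open>simp_all add: laplacian_entry sum_distrib_right left_diff_distrib\<close>)
  also have "\<dots> = (\<Sum>w\<in>neighbours E v. \<Sum>u = 0..<n. of_bool (u = v) * g u - of_bool (u = w) * g u)"
    by (rule sum.swap)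
  also have "\<dots> = (\<Sum>w\<in>neighbours E v. g v - g w)"
  proof (rule sum.cong[OF refl])
    fix w assume "w \<in> neighbours E v"
    then have "w < n"
      using neighbours_subset[OF assms(1), of v] by auto
    then show "(\<Sum>u = 0..<n. of_bool (u = v) * g u - of_bool (u = w) * g u) = g v - g w"
      using assms(2) unfolding sum_subtractf by (simp only: sum_of_bool_mult)
  qed
  finally show ?thesis .
qed

lemma matrix_tree_plus_ones:
  assumes "simple_graph {0..<n} E" "n > 0"
  shows "det (mat n n (\<lambda>(v, u). laplacian n E $$ (v, u) + 1) :: 'a::field_char_0 mat)
    = of_nat n ^ 2 * of_nat (card (spanning_trees {0..<n} E))"
proof -
  have rows: "(\<Sum>u = 0..<n. laplacian n E $$ (v, u) :: 'a) = 0" if "v < n" for v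
    using laplacian_mult_sum[OF assms(1) that, of "\<lambda>_. 1"] by simp
  have "laplacian n E $$ (v, u) = (laplacian n E $$ (u, v) :: 'a)" if "v < n" "u < n" for u v
    using that by (auto simp: laplacian_def insert_commute)
  with rows have cols: "(\<Sum>v = 0..<n. laplacian n E $$ (v, u) :: 'a) = 0" if "u < n" for u
    using that by (metis (no_types, lifting) atLeastLessThan_iff sum.cong)
  show ?thesis
    using det_plus_ones[OF laplacian_carrier assms(2) rows cols] matrix_tree[OF assms, where 'a = 'a]
    by simp
qed

section \<open>Determinants from the discrete Fourier basis\<close>

lemma det_eq_prod_eigenvalues:
  fixes A :: "'a::field mat"
  assumes A: "A \<in> carrier_mat n n" and F: "F \<in> carrier_mat n n" "det F \<noteq> 0"
    and eigen: "\<And>v j. v < n \<Longrightarrow> j < n \<Longrightarrow> (\<Sum>u = 0..<n. A $$ (v, u) * F $$ (u, j)) = \<mu> j * F $$ (v, j)"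
  shows "det A = (\<Prod>j = 0..<n. \<mu> j)"
proof -
  have "A * F = F * mat_diag n \<mu>"
    using A F eigen by (intro eq_matI) (auto simp: mat_diag_mult_right scalar_prod_def)
  then have "det A * det F = det F * det (mat_diag n \<mu>)"
    using det_mult[OF A F(1)] det_mult[OF F(1) mat_diag_dim] by metis
  moreover have "det (mat_diag n \<mu>) = (\<Prod>j = 0..<n. \<mu> j)"
    using det_upper_triangular[of "mat_diag n \<mu>" n]
    by (simp add: prod_list_diag_prod mat_diag_def upper_triangular_def)
  ultimately show ?thesis
    using F(2) by simp
qed

text \<open>
  Integer exponents let jumps in both directions be treated alike.
\<close>

definition zeta :: "nat \<Rightarrow> int \<Rightarrow> complex" where
  "zeta n a = cis (2 * pi * of_int a / of_nat n)"

lemma zeta_0 [simp]: "zeta n 0 = 1"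
  by (simp add: zeta_def)

lemma zeta_add: "zeta n (a + b) = zeta n a * zeta n b"
  by (simp add: zeta_def cis_mult add_divide_distrib distrib_left)

lemma zeta_uminus: "zeta n (- a) = inverse (zeta n a)"
  by (simp add: zeta_def)

lemma zeta_power: "zeta n (a * int m) = zeta n a ^ m"
  by (induction m) (simp_all add: distrib_left zeta_add)

lemma zeta_multiple: "n > 0 \<Longrightarrow> zeta n (int n * a) = 1"
  using cis_multiple_2pi[of "of_int a"] by (simp add: zeta_def mult.assoc)

lemma zeta_cong:
  assumes "n > 0" "[a = b] (mod int n)"
  shows "zeta n a = zeta n b"
proof -
  from assms(2) obtain c where "b = a + int n * c"
    by (auto simp: cong_iff_lin)
  then show ?thesis
    using assms(1) by (simp add: zeta_add zeta_multiple)
qed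

lemma zeta_uminus_sum: "zeta n a + zeta n (- a) = 2 * complex_of_real (cos (2 * pi * of_int a / of_nat n))"
  by (simp add: zeta_def complex_eq_iff)

lemma bij_betw_zeta: "n > 0 \<Longrightarrow> bij_betw (\<lambda>j. zeta n (int j)) {0..<n} {z. z ^ n = 1}"
  using bij_betw_roots_unity[of n] by (simp add: zeta_def atLeast0LessThan)

lemma sum_zeta:
  assumes "n > 0" "i < n" "j < n"
  shows "(\<Sum>u = 0..<n. zeta n (int u * (int i - int j))) = (if i = j then of_nat n else 0)"
proof (cases "i = j")
  case False
  define z where "z = zeta n (int i - int j)"
  have "z * zeta n (int j) = zeta n (int i)"
    by (simp add: z_def flip: zeta_add)
  moreover have "zeta n (int i) \<noteq> zeta n (int j)"
    using bij_betw_zeta[OF assms(1)] False assms by (auto simp: bij_betw_def inj_on_def)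
  ultimately have "z \<noteq> 1"
    by auto
  moreover have "z ^ n = 1"
    using zeta_multiple[OF assms(1)] by (simp add: z_def mult.commute[of _ "int n"] flip: zeta_power)
  ultimately have "(\<Sum>u<n. z ^ u) = 0"
    by (simp add: geometric_sum)
  then show ?thesis
    using False by (simp add: z_def atLeast0LessThan mult.commute flip: zeta_power)
qed simp

definition fourier_matrix :: "nat \<Rightarrow> complex mat" where
  "fourier_matrix n = mat n n (\<lambda>(u, j). zeta n (int u * int j))"

text \<open>
  By orthogonality of characters, the conjugate of the Fourier matrix is \<open>n\<close> times its inverse.
\<close>

lemma det_fourier_matrix:
  assumes "n > 0"
  shows "det (fourier_matrix n) \<noteq> 0"
proof
  define G where "G = mat n n (\<lambda>(u, j). zeta n (- (int u * int j)))"
  assume "det (fourier_matrix n) = 0"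
  then have "det (G * fourier_matrix n) = 0"
    by (subst det_mult[of _ n]) (simp_all add: G_def fourier_matrix_def)
  moreover have "G * fourier_matrix n = of_nat n \<cdot>\<^sub>m 1\<^sub>m n"
  proof (rule eq_matI)
    fix i j assume "i < dim_row (of_nat n \<cdot>\<^sub>m 1\<^sub>m n :: complex mat)"
      "j < dim_col (of_nat n \<cdot>\<^sub>m 1\<^sub>m n :: complex mat)"
    then have ij: "i < n" "j < n" by simp_all
    have "(G * fourier_matrix n) $$ (i, j)
        = (\<Sum>u = 0..<n. zeta n (- (int i * int u)) * zeta n (int u * int j))"
      using ij by (simp add: G_def fourier_matrix_def scalar_prod_def)
    also have "\<dots> = (\<Sum>u = 0..<n. zeta n (int u * (int j - int i)))"
      by (simp add: algebra_simps flip: zeta_add)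
    also have "\<dots> = (of_nat n \<cdot>\<^sub>m 1\<^sub>m n) $$ (i, j)"
      using ij assms by (simp add: sum_zeta)
    finally show "(G * fourier_matrix n) $$ (i, j) = (of_nat n \<cdot>\<^sub>m 1\<^sub>m n) $$ (i, j)" .
  qed (simp_all add: G_def fourier_matrix_def)
  ultimately show False
    using assms by simp
qed

section \<open>Factorization of Chebyshev polynomials at roots of unity\<close>

text \<open>
  This is \<open>T\<^sub>m (cos x) = cos (m x)\<close> with \<open>z\<close> in place of \<open>e\<^sup>i\<^sup>x\<close>.
\<close>

lemma poly_chebyshev_T_joukowski:
  fixes z :: complex
  assumes "z \<noteq> 0"
  shows "poly (chebyshev_T m) ((z + inverse z) / 2) = (z ^ m + inverse z ^ m) / 2"
proof (induction m rule: chebyshev_T.induct)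
  case (3 m)
  define y where "y = inverse z"
  have "z * y = 1"
    using assms by (simp add: y_def)
  then have cancel: "z * (y * a) = a" "y * (z * a) = a" for a
  proof -
    have "z * (y * a) = (z * y) * a" "y * (z * a) = (z * y) * a"
      by (simp_all only: mult_ac)
    with \<open>z * y = 1\<close> show "z * (y * a) = a" "y * (z * a) = a"
      by simp_all
  qed
  define x where "x = (z + y) / 2"
  have IH: "poly (chebyshev_T (Suc m)) x = (z ^ Suc m + y ^ Suc m) / 2"
    "poly (chebyshev_T m) x = (z ^ m + y ^ m) / 2"
    using 3 by (simp_all only: x_def y_def)
  have "poly (chebyshev_T (Suc (Suc m))) x = 2 * x * poly (chebyshev_T (Suc m)) x - poly (chebyshev_T m) x"
    by simp
  also have "\<dots> = (z + y) * ((z ^ Suc m + y ^ Suc m) / 2) - (z ^ m + y ^ m) / 2"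
    unfolding IH by (simp add: x_def)
  also have "\<dots> = (z ^ Suc (Suc m) + y ^ Suc (Suc m)) / 2"
    by (simp add: field_simps cancel)
  finally show ?case
    by (simp only: x_def y_def)
qed simp_all

lemma prod_roots_unity:
  fixes z :: complex
  assumes "n > 0"
  shows "(\<Prod>x | x ^ n = 1. z - x) = z ^ n - 1"
proof -
  define S where "S = {x::complex. x ^ n = 1}"
  have S: "card S = n" "finite S"
    using card_roots_unity_eq[OF assms] finite_roots_unity[of n] assms by (simp_all add: S_def)
  define p where "p = (\<Prod>x\<in>S. [:- x, 1:])"
  have "p = Polynomial.monom 1 n - 1"
  proof (rule poly_eqI_degree_lead_coeff[where A = S and n = n])
    have deg: "degree p = n"
      by (simp add: p_def S degree_prod_eq_sum_degree)
    then show "degree p \<le> n" by simp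
    have "lead_coeff p = 1"
      by (simp add: p_def lead_coeff_prod)
    then show "Polynomial.coeff p n = Polynomial.coeff (Polynomial.monom 1 n - 1) n"
      using assms deg by simp
    show "degree (Polynomial.monom 1 n - 1 :: complex poly) \<le> n"
      by (rule degree_diff_le) (simp_all add: degree_monom_eq)
    show "poly p x = poly (Polynomial.monom 1 n - 1) x" if "x \<in> S" for x
      using that S by (auto simp: p_def poly_prod poly_monom S_def)
  qed (simp add: S)
  then have "poly p z = z ^ n - 1"
    by (simp add: poly_monom)
  then show ?thesis
    by (simp add: p_def S_def poly_prod)
qed

text \<open>
  The roots of \<open>T\<^sub>n - 1\<close>, which are the real parts of the \<open>n\<close>-th roots of unity.
\<close>

definition node :: "nat \<Rightarrow> nat \<Rightarrow> complex" where
  "node n j = complex_of_real (cos (2 * pi * real j / real n))"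

lemma node_conv_zeta: "node n j = (zeta n (int j) + inverse (zeta n (int j))) / 2"
  using zeta_uminus_sum[of n "int j"] by (simp add: node_def zeta_uminus)

text \<open>
  Write \<open>w = (z + 1/z) / 2\<close>. Then \<open>2 (T\<^sub>n(w) - 1) = (z\<^sup>n - 1)\<^sup>2 / z\<^sup>n\<close>, and for a root of unity \<open>x\<close> with
  real part \<open>c\<close> one has \<open>w - c = (z - x) (z - 1/x) / (2 z)\<close>. Multiplying over all \<open>x\<close>, both factors
  of the numerator contribute \<open>z\<^sup>n - 1\<close>.
\<close>

lemma chebyshev_T_minus_1_factorization:
  assumes "n > 0"
  shows "chebyshev_T n - 1 = Polynomial.smult (2 ^ (n - 1)) (\<Prod>j = 0..<n. [:- node n j, 1:])"
proof (rule poly_eq_poly_eq_iff[THEN iffD1], rule ext)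
  fix w :: complex
  \<comment> \<open>a root \<open>z\<close> of \<open>z\<^sup>2 - 2 w z + 1\<close>; the other root is its inverse\<close>
  define r where "r = csqrt (w\<^sup>2 - 1)"
  define z where "z = w + r"
  have "z * (w - r) = w\<^sup>2 - r\<^sup>2"
    by (simp add: z_def algebra_simps power2_eq_square)
  also have "\<dots> = 1"
    by (simp add: r_def)
  finally have inv: "z * (w - r) = 1" .
  then have z: "z \<noteq> 0" "inverse z = w - r"
    by (auto intro: inverse_unique)
  then have w: "w = (z + inverse z) / 2"
    by (simp add: z_def)
  have half: "(2::complex) ^ n = 2 * 2 ^ (n - 1)"
    using assms by (cases n) simp_all
  define S where "S = {x::complex. x ^ n = 1}"
  have card: "card S = n"
    using card_roots_unity_eq[OF assms] by (simp add: S_def)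
  have S0: "x \<noteq> 0" if "x \<in> S" for x
    using that assms by (auto simp: S_def zero_power)
  have inv_S: "(\<Prod>x\<in>S. z - inverse x) = (\<Prod>x\<in>S. z - x)"
    by (rule prod.reindex_bij_witness[of _ inverse inverse]) (auto simp: S_def power_inverse)
  have "(\<Prod>j = 0..<n. w - node n j) = (\<Prod>x\<in>S. w - (x + inverse x) / 2)"
    unfolding node_conv_zeta S_def
    by (rule prod.reindex_bij_betw[OF bij_betw_zeta[OF assms]])
  also have "\<dots> = (\<Prod>x\<in>S. (z - x) * (z - inverse x) / (2 * z))"
    by (rule prod.cong) (use z S0 in \<open>auto simp: w field_simps\<close>)
  also have "\<dots> = (z ^ n - 1)\<^sup>2 / (2 ^ n * z ^ n)"
    using prod_roots_unity[OF assms, of z]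
    by (simp add: prod_dividef prod.distrib inv_S card power_mult_distrib power2_eq_square flip: S_def)
  finally have "2 ^ n * (\<Prod>j = 0..<n. w - node n j) = (z ^ n - 1)\<^sup>2 / z ^ n"
    by simp
  also have "\<dots> = 2 * (poly (chebyshev_T n) w - 1)"
    unfolding w poly_chebyshev_T_joukowski[OF z(1)]
    using z by (simp add: field_simps power2_eq_square power_inverse)
  finally have "2 * (2 ^ (n - 1) * (\<Prod>j = 0..<n. w - node n j)) = 2 * (poly (chebyshev_T n) w - 1)"
    by (simp only: half mult.assoc)
  then have "2 ^ (n - 1) * (\<Prod>j = 0..<n. w - node n j) = poly (chebyshev_T n) w - 1"
    by (subst (asm) mult_cancel_left) simp
  then show "poly (chebyshev_T n - 1) w = poly (Polynomial.smult (2 ^ (n - 1)) (\<Prod>j = 0..<n. [:- node n j, 1:])) w"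
    by (simp add: poly_prod)
qed

lemma chebyshev_quot_factorization:
  assumes "n > 0"
  shows "chebyshev_quot n = Polynomial.smult (2 ^ (n - 1)) (\<Prod>j = 1..<n. [:- node n j, 1:])"
proof -
  have "{0..<n} = insert 0 {1..<n}"
    using assms by auto
  then have "chebyshev_quot n * [:-1, 1:]
      = Polynomial.smult (2 ^ (n - 1)) (\<Prod>j = 1..<n. [:- node n j, 1:]) * [:-1, 1:]"
    unfolding chebyshev_quot_mult chebyshev_T_minus_1_factorization[OF assms]
    by (simp add: node_def algebra_simps)
  then show ?thesis
    by (subst (asm) mult_cancel_right) simp
qed

lemma poly_chebyshev_quot_mult: "poly (chebyshev_quot m) w * (w - 1) = poly (chebyshev_T m) w - 1"
proof -
  have "poly (chebyshev_quot m * [:-1, 1:]) w = poly (chebyshev_T m - 1) w"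
    by (simp only: chebyshev_quot_mult)
  then show ?thesis
    by (simp add: algebra_simps)
qed

lemma degree_chebyshev_quot: "degree (chebyshev_quot m) = m - 1"
  and lead_coeff_chebyshev_quot: "m > 0 \<Longrightarrow> lead_coeff (chebyshev_quot m) = 2 ^ (m - 1)"
proof -
  have deg: "degree (chebyshev_quot m) = m - 1" if "m > 0"
    unfolding chebyshev_quot_factorization[OF that]
    by (simp add: degree_prod_eq_sum_degree)
  then show "degree (chebyshev_quot m) = m - 1"
    by (cases "m = 0") (auto simp: chebyshev_quot_def)
  show "lead_coeff (chebyshev_quot m) = 2 ^ (m - 1)" if "m > 0"
    unfolding chebyshev_quot_factorization[OF that]
    by (simp add: lead_coeff_smult lead_coeff_prod)
qed

text \<open>
  The jumps increase strictly, so the last quotient alone determines the leading term.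
\<close>

lemma circulant_poly_leading:
  assumes "k \<ge> 1" "s 1 \<ge> 1" "strict_mono_on {1..k} s"
  shows "degree (circulant_poly k s) = s k - 1" "lead_coeff (circulant_poly k s) = 2 ^ (s k - 1)"
proof -
  have s: "s j < s k" if "j \<in> {1..<k}" for j
    using assms that by (auto simp: strict_mono_on_def)
  have sk: "s k > 0"
    using assms(2) s[of 1] assms(1) by (cases "k = 1") auto
  define q where "q = (\<Sum>j = 1..<k. chebyshev_quot (s j))"
  have "{1..k} = insert k {1..<k}"
    using assms(1) by auto
  then have split: "circulant_poly k s = chebyshev_quot (s k) + q"
    by (simp add: circulant_poly_def q_def)
  have low: "Polynomial.coeff q i = 0" if "i \<ge> s k - 1" for i
  proof -
    have "Polynomial.coeff (chebyshev_quot (s j)) i = 0" if "j \<in> {1..<k}" for j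
    proof (cases "s j = 0")
      case True
      then show ?thesis by (simp add: chebyshev_quot_def)
    next
      case False
      show ?thesis
        by (rule coeff_eq_0) (use s[OF that] \<open>i \<ge> s k - 1\<close> False in \<open>simp add: degree_chebyshev_quot\<close>)
    qed
    then show ?thesis
      by (simp add: q_def coeff_sum)
  qed
  have top: "Polynomial.coeff (circulant_poly k s) (s k - 1) = 2 ^ (s k - 1)"
    using lead_coeff_chebyshev_quot[OF sk] low by (simp add: split degree_chebyshev_quot)
  have "degree (circulant_poly k s) \<le> s k - 1"
    by (rule degree_le) (auto simp: split low degree_chebyshev_quot intro!: coeff_eq_0)
  moreover have "s k - 1 \<le> degree (circulant_poly k s)"
    by (rule le_degree) (simp only: top, simp)
  ultimately show "degree (circulant_poly k s) = s k - 1"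
    by simp
  with top show "lead_coeff (circulant_poly k s) = 2 ^ (s k - 1)"
    by simp
qed

lemma prod_2_minus_2_node:
  assumes "n > 0"
  shows "(\<Prod>j = 1..<n. 2 * (1 - node n j)) = of_nat n ^ 2"
proof -
  have "of_nat n ^ 2 = poly (chebyshev_quot n) 1"
    by (simp add: poly_chebyshev_quot_1)
  also have "\<dots> = 2 ^ (n - 1) * (\<Prod>j = 1..<n. 1 - node n j)"
    by (simp add: chebyshev_quot_factorization[OF assms] poly_prod)
  also have "\<dots> = (\<Prod>j = 1..<n. 2 * (1 - node n j))"
    by (simp only: prod.distrib prod_constant card_atLeastLessThan)
  finally show ?thesis ..
qed

text \<open>
  Up to sign and leading coefficients, both sides are the resultant of \<open>p\<close> and
  \<open>(T\<^sub>n - 1) / (w - 1)\<close>, the product of all differences between their roots: the left side takes the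
  values of \<open>p\<close> at the roots of the second polynomial, the right side those of the second
  polynomial at the roots of \<open>p\<close>.
\<close>

lemma prod_poly_node:
  assumes "n > 0" "poly p 1 \<noteq> 0"
  shows "(\<Prod>j = 1..<n. poly p (node n j)) =
    lead_coeff p ^ (n - 1) *
    (\<Prod>w\<in>#proots p. (-1) ^ (n - 1) * ((poly (chebyshev_T n) w - 1) / (w - 1)) / 2 ^ (n - 1))"
proof -
  have quot: "(poly (chebyshev_T n) w - 1) / (w - 1) = poly (chebyshev_quot n) w" if "w \<noteq> 1" for w
    using poly_chebyshev_quot_mult[of n w, symmetric] that by simp
  have poly_p: "poly p x = lead_coeff p * (\<Prod>w\<in>#proots p. x - w)" for x
    by (subst complex_poly_decompose_multiset[of p, symmetric]) (simp add: poly_prod_mset image_mset.compositionality o_def)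
  have "(\<Prod>j = 1..<n. poly p (node n j))
      = lead_coeff p ^ (n - 1) * (\<Prod>j = 1..<n. \<Prod>w\<in>#proots p. node n j - w)"
    by (subst poly_p) (simp add: prod.distrib)
  also have "(\<Prod>j = 1..<n. \<Prod>w\<in>#A. node n j - w) = (\<Prod>w\<in>#A. \<Prod>j = 1..<n. node n j - w)" for A
    by (induction A) (simp_all add: prod.distrib)
  also have "(\<Prod>w\<in>#proots p. \<Prod>j = 1..<n. node n j - w) =
      (\<Prod>w\<in>#proots p. (-1) ^ (n - 1) * ((poly (chebyshev_T n) w - 1) / (w - 1)) / 2 ^ (n - 1))"
  proof (intro arg_cong[of _ _ prod_mset] image_mset_cong)
    fix w assume "w \<in># proots p"
    then have "poly p w = 0"
      using assms(2) by (cases "p = 0") auto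
    with assms(2) have "w \<noteq> 1" by auto
    have "(\<Prod>j = 1..<n. node n j - w) = (\<Prod>j = 1..<n. (-1) * (w - node n j))"
      by simp
    also have "\<dots> = (-1) ^ (n - 1) * (\<Prod>j = 1..<n. w - node n j)"
      unfolding prod.distrib by simp
    also have "\<dots> = (-1) ^ (n - 1) * poly (chebyshev_quot n) w / 2 ^ (n - 1)"
      by (simp add: chebyshev_quot_factorization[OF assms(1)] poly_prod)
    finally show "(\<Prod>j = 1..<n. node n j - w)
        = (-1) ^ (n - 1) * ((poly (chebyshev_T n) w - 1) / (w - 1)) / 2 ^ (n - 1)"
      by (simp only: quot[OF \<open>w \<noteq> 1\<close>])
  qed
  finally show ?thesis .
qed

section \<open>Circulant graphs\<close>

text \<open>
  The signed jumps, kept as integers so that their residues modulo \<open>n\<close> can be compared by size.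
\<close>

definition offsets :: "nat \<Rightarrow> (nat \<Rightarrow> nat) \<Rightarrow> int set" where
  "offsets k s = (\<lambda>j. int (s j)) ` {1..k} \<union> (\<lambda>j. - int (s j)) ` {1..k}"

lemma offsets_uminus: "- d \<in> offsets k s \<longleftrightarrow> d \<in> offsets k s"
  by (force simp: offsets_def)

lemma circulant_edges_iff:
  "{v, u} \<in> circulant_edges n k s \<longleftrightarrow>
     v < n \<and> u < n \<and> (\<exists>d\<in>offsets k s. [int u = int v + d] (mod int n))"
proof -
  define C where "C a b \<longleftrightarrow> (\<exists>d\<in>offsets k s. [int b = int a + d] (mod int n))" for a b
  have step: "(\<exists>j\<in>{1..k}. [int b = int a + int (s j)] (mod int n) \<or> [int b = int a - int (s j)] (mod int n))
      \<longleftrightarrow> C a b" for a b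
    by (simp add: C_def offsets_def bex_Un diff_conv_add_uminus del: add_uminus_conv_diff) blast
  have sym: "C b a" if "C a b" for a b
  proof -
    from that obtain d where d: "d \<in> offsets k s" "[int b = int a + d] (mod int n)"
      by (auto simp: C_def)
    have "int a - (int b + (- d)) = - (int b - (int a + d))"
      by simp
    with d(2) have "[int a = int b + (- d)] (mod int n)"
      by (simp only: cong_iff_dvd_diff dvd_minus_iff)
    with d(1) show ?thesis
      unfolding C_def by (intro bexI[of _ "- d"]) (simp_all only: offsets_uminus)
  qed
  show ?thesis
    unfolding circulant_edges_def step C_def[symmetric] by (auto simp: doubleton_eq_iff dest: sym)
qed

lemma simple_graph_circulant:
  assumes "\<And>j. j \<in> {1..k} \<Longrightarrow> 1 \<le> s j \<and> s j < n"
  shows "simple_graph {0..<n} (circulant_edges n k s)"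
  unfolding simple_graph_def
proof (intro conjI ballI)
  fix e assume e: "e \<in> circulant_edges n k s"
  then obtain v u where vu: "e = {v, u}" "v < n" "u < n"
    by (auto simp: circulant_edges_def)
  have "v \<noteq> u"
  proof
    assume "v = u"
    with e vu obtain d where d: "d \<in> offsets k s" "[int v = int v + d] (mod int n)"
      using circulant_edges_iff[of v u n k s] by auto
    then have "int n dvd d"
      by (simp add: cong_iff_dvd_diff)
    moreover have "d \<noteq> 0" "\<bar>d\<bar> < int n"
      using d(1) assms by (fastforce simp: offsets_def)+
    ultimately show False
      using zdvd_not_zless[of "\<bar>d\<bar>" "int n"] by auto
  qed
  with vu show "\<exists>u\<in>{0..<n}. \<exists>v\<in>{0..<n}. u \<noteq> v \<and> e = {u, v}"
    by (intro bexI[of _ v] bexI[of _ u]) simp_all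
qed simp

text \<open>
  Jumps below \<open>n / 2\<close> have residues \<open>\<plusminus> s j\<close> modulo \<open>n\<close> that are pairwise different, so every vertex has
  \<open>2 k\<close> different neighbours.
\<close>

lemma sum_neighbours_circulant:
  fixes g :: "nat \<Rightarrow> 'a::comm_monoid_add"
  assumes "\<And>j. j \<in> {1..k} \<Longrightarrow> 1 \<le> s j \<and> 2 * s j < n" "inj_on s {1..k}" "v < n"
  shows "(\<Sum>w\<in>neighbours (circulant_edges n k s) v. g w) =
    (\<Sum>j = 1..k. g (nat ((int v + int (s j)) mod int n)) + g (nat ((int v - int (s j)) mod int n)))"
proof -
  define h where "h d = nat ((int v + d) mod int n)" for d
  have n: "n > 0" using assms(3) by simp
  have inj: "inj_on h (offsets k s)"
  proof (rule inj_onI)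
    fix d d' assume d: "d \<in> offsets k s" "d' \<in> offsets k s" "h d = h d'"
    then have "(int v + d) mod int n = (int v + d') mod int n"
      using n by (simp add: h_def eq_nat_nat_iff)
    then have "int n dvd d - d'"
      by (metis add_diff_cancel_left mod_eq_dvd_iff)
    moreover have "2 * \<bar>d\<bar> < int n" "2 * \<bar>d'\<bar> < int n"
      using d(1,2) assms(1) by (fastforce simp: offsets_def)+
    then have "\<bar>d - d'\<bar> < int n"
      by linarith
    ultimately show "d = d'"
      using dvd_imp_le_int[of "d - d'" "int n"] by fastforce
  qed
  have "neighbours (circulant_edges n k s) v = h ` offsets k s"
  proof (rule Set.set_eqI)
    fix u
    have "u < n \<and> [int u = int v + d] (mod int n) \<longleftrightarrow> u = h d" for d
      using n by (auto simp: h_def cong_def nat_less_iff)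
    then show "u \<in> neighbours (circulant_edges n k s) v \<longleftrightarrow> u \<in> h ` offsets k s"
      using assms(3) by (auto simp: neighbours_def circulant_edges_iff)
  qed
  moreover have disj: "(\<lambda>j. int (s j)) ` {1..k} \<inter> (\<lambda>j. - int (s j)) ` {1..k} = {}"
  proof -
    have "int (s i) \<noteq> - int (s j)" if "i \<in> {1..k}" for i j
      using assms(1)[OF that] by simp
    then show ?thesis
      by blast
  qed
  ultimately have "(\<Sum>w\<in>neighbours (circulant_edges n k s) v. g w) = (\<Sum>d\<in>offsets k s. g (h d))"
    using inj by (simp add: sum.reindex)
  also have "\<dots> = (\<Sum>d\<in>(\<lambda>j. int (s j)) ` {1..k}. g (h d)) + (\<Sum>d\<in>(\<lambda>j. - int (s j)) ` {1..k}. g (h d))"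
    unfolding offsets_def by (rule sum.union_disjoint) (use disj in simp_all)
  also have "\<dots> = (\<Sum>j = 1..k. g (h (int (s j)))) + (\<Sum>j = 1..k. g (h (- int (s j))))"
  proof -
    have inj: "inj_on (\<lambda>j. int (s j)) {1..k}" "inj_on (\<lambda>j. - int (s j)) {1..k}"
      by (intro inj_onI; simp add: inj_on_eq_iff[OF assms(2)])+
    show ?thesis
      unfolding sum.reindex[OF inj(1)] sum.reindex[OF inj(2)] o_def ..
  qed
  finally show ?thesis
    by (simp add: h_def sum.distrib)
qed

text \<open>
  The usual eigenvalue of the Laplacian is the sum of the numbers \<open>2 - 2 cos (2 \<pi> j s\<^sub>i / n)\<close> over all
  jumps \<open>s\<^sub>i\<close>. As \<open>cos (s x) = T\<^sub>s (cos x)\<close>, it is \<open>- 2 (c - 1) P(c)\<close> where \<open>c = cos (2 \<pi> j / n)\<close> and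
  \<open>P\<close> is the polynomial of the graph.
\<close>

definition circulant_eigenvalue :: "nat \<Rightarrow> nat \<Rightarrow> (nat \<Rightarrow> nat) \<Rightarrow> nat \<Rightarrow> complex" where
  "circulant_eigenvalue n k s j = 2 * (1 - node n j) * poly (circulant_poly k s) (node n j)"

lemma circulant_eigenvalue_conv_zeta:
  "circulant_eigenvalue n k s j =
    (\<Sum>i = 1..k. 2 - (zeta n (int (s i) * int j) + zeta n (- (int (s i) * int j))))"
proof -
  define c where "c = node n j"
  have T: "zeta n (int m * int j) + zeta n (- (int m * int j)) = 2 * poly (chebyshev_T m) c" for m
  proof -
    have "c = cos (complex_of_real (2 * pi * real j / real n))"
      by (simp only: c_def node_def cos_of_real)
    then have "poly (chebyshev_T m) c = cos (of_nat m * complex_of_real (2 * pi * real j / real n))"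
      by (simp only: poly_chebyshev_T_cos)
    also have "\<dots> = complex_of_real (cos (2 * pi * of_int (int m * int j) / of_nat n))"
      by (simp add: mult_ac flip: cos_of_real)
    finally show ?thesis
      by (simp only: zeta_uminus_sum)
  qed
  have quot: "2 * (1 - c) * poly (chebyshev_quot m) c = 2 - 2 * poly (chebyshev_T m) c" for m
  proof -
    have "2 * (1 - c) * poly (chebyshev_quot m) c = - 2 * (poly (chebyshev_quot m) c * (c - 1))"
      by (simp add: algebra_simps)
    then show ?thesis
      by (simp add: poly_chebyshev_quot_mult)
  qed
  show ?thesis
    unfolding circulant_eigenvalue_def circulant_poly_def poly_sum sum_distrib_left T
    by (simp only: quot flip: c_def)
qed

lemma laplacian_circulant_eigenvector:
  assumes "\<And>j. j \<in> {1..k} \<Longrightarrow> 1 \<le> s j \<and> 2 * s j < n" "inj_on s {1..k}" "v < n"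
  shows "(\<Sum>u = 0..<n. laplacian n (circulant_edges n k s) $$ (v, u) * zeta n (int u * int j))
    = circulant_eigenvalue n k s j * zeta n (int v * int j)"
proof -
  have n: "n > 0" using assms(3) by simp
  have simple: "simple_graph {0..<n} (circulant_edges n k s)"
    by (rule simple_graph_circulant) (use assms(1) in force)
  have shift: "zeta n (int (nat ((int v + d) mod int n)) * int j) = zeta n (int v * int j) * zeta n (d * int j)" for d
  proof -
    have "[int (nat ((int v + d) mod int n)) * int j = (int v + d) * int j] (mod int n)"
      using n by (intro cong_scalar_right) (simp add: cong_def)
    from zeta_cong[OF n this] show ?thesis
      by (simp add: distrib_right zeta_add)
  qed
  define z where "z = zeta n (int v * int j)"
  have "(\<Sum>u = 0..<n. laplacian n (circulant_edges n k s) $$ (v, u) * zeta n (int u * int j))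
      = (\<Sum>w\<in>neighbours (circulant_edges n k s) v. z - zeta n (int w * int j))"
    unfolding z_def by (rule laplacian_mult_sum[OF simple assms(3)])
  also have "\<dots> = (\<Sum>i = 1..k. (z - z * zeta n (int (s i) * int j)) + (z - z * zeta n (- int (s i) * int j)))"
  proof (rule trans[OF sum_neighbours_circulant sum.cong[OF refl]])
    fix i
    show "z - zeta n (int (nat ((int v + int (s i)) mod int n)) * int j)
        + (z - zeta n (int (nat ((int v - int (s i)) mod int n)) * int j))
        = (z - z * zeta n (int (s i) * int j)) + (z - z * zeta n (- int (s i) * int j))"
      using shift[of "int (s i)"] shift[of "- int (s i)"] by (simp add: z_def)
  qed (use assms in auto)
  also have "\<dots> = circulant_eigenvalue n k s j * z"
    unfolding circulant_eigenvalue_conv_zeta sum_distrib_right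
    by (rule sum.cong) (simp_all add: algebra_simps)
  finally show ?thesis
    by (simp add: z_def)
qed

text \<open>
  The matrix \<open>L + J\<close> is diagonal in the Fourier basis. Its eigenvalue is \<open>n\<close> at \<open>j = 0\<close>, where \<open>L\<close>
  contributes \<open>0\<close>, and that of \<open>L\<close> at every other \<open>j\<close>.
\<close>

lemma spanning_trees_circulant:
  assumes "\<And>j. j \<in> {1..k} \<Longrightarrow> 1 \<le> s j \<and> 2 * s j < n" "inj_on s {1..k}" "n > 0"
  shows "of_nat n * of_nat (card (spanning_trees {0..<n} (circulant_edges n k s)))
    = (\<Prod>j = 1..<n. circulant_eigenvalue n k s j)"
proof -
  define L :: "complex mat" where "L = laplacian n (circulant_edges n k s)"
  define \<mu> where "\<mu> j = (if j = 0 then of_nat n else circulant_eigenvalue n k s j)" for j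
  have simple: "simple_graph {0..<n} (circulant_edges n k s)"
    by (rule simple_graph_circulant) (use assms(1) in force)
  have "det (mat n n (\<lambda>(v, u). L $$ (v, u) + 1)) = (\<Prod>j = 0..<n. \<mu> j)"
  proof (rule det_eq_prod_eigenvalues)
    show "det (fourier_matrix n) \<noteq> 0"
      by (rule det_fourier_matrix[OF assms(3)])
    fix v j assume vj: "v < n" "j < n"
    have "(\<Sum>u = 0..<n. mat n n (\<lambda>(v, u). L $$ (v, u) + 1) $$ (v, u) * fourier_matrix n $$ (u, j))
        = (\<Sum>u = 0..<n. L $$ (v, u) * zeta n (int u * int j)) + (\<Sum>u = 0..<n. zeta n (int u * int j))"
      using vj by (simp add: fourier_matrix_def distrib_right sum.distrib)
    also have "(\<Sum>u = 0..<n. zeta n (int u * int j)) = (if j = 0 then of_nat n else 0)"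
      using sum_zeta[OF assms(3) vj(2) assms(3)] by simp
    also have "(\<Sum>u = 0..<n. L $$ (v, u) * zeta n (int u * int j))
        = circulant_eigenvalue n k s j * zeta n (int v * int j)"
      unfolding L_def by (rule laplacian_circulant_eigenvector[OF assms(1,2) vj(1)])
    also have "\<dots> + (if j = 0 then of_nat n else 0) = \<mu> j * fourier_matrix n $$ (v, j)"
      using vj by (simp add: \<mu>_def fourier_matrix_def circulant_eigenvalue_def node_def)
    finally show "(\<Sum>u = 0..<n. mat n n (\<lambda>(v, u). L $$ (v, u) + 1) $$ (v, u) * fourier_matrix n $$ (u, j))
        = \<mu> j * fourier_matrix n $$ (v, j)" .
  qed (simp_all add: fourier_matrix_def)
  also have "{0..<n} = insert 0 {1..<n}"
    using assms(3) by auto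
  then have "(\<Prod>j = 0..<n. \<mu> j) = of_nat n * (\<Prod>j = 1..<n. \<mu> j)"
    by (simp add: \<mu>_def)
  also have "(\<Prod>j = 1..<n. \<mu> j) = (\<Prod>j = 1..<n. circulant_eigenvalue n k s j)"
    by (rule prod.cong) (simp_all add: \<mu>_def)
  finally have "of_nat n ^ 2 * of_nat (card (spanning_trees {0..<n} (circulant_edges n k s)))
      = of_nat n * (\<Prod>j = 1..<n. circulant_eigenvalue n k s j)"
    unfolding L_def matrix_tree_plus_ones[OF simple assms(3)] .
  then show ?thesis
    using assms(3) by (simp add: power2_eq_square)
qed

text \<open>
  The factors \<open>2 (1 - c)\<close> of the eigenvalues multiply to \<open>n\<^sup>2\<close>, one \<open>n\<close> of which is cancelled. The
  values \<open>P(c)\<close> are turned into values of \<open>(T\<^sub>n - 1) / (w - 1)\<close> at the roots of \<open>P\<close>. The powers of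
  \<open>2\<close> from the two leading coefficients cancel, because each of the \<open>s\<^sub>k - 1\<close> roots of \<open>P\<close> meets
  \<open>n - 1\<close> values of \<open>c\<close>, and what remains is the sign.
\<close>

theorem theorem1:
  fixes n k :: nat and s :: "nat \<Rightarrow> nat"
  assumes "k \<ge> 1"
    and "s 1 \<ge> 1"
    and "strict_mono_on {1..k} s"
    and "real (s k) < real n / 2"
    and "graph_connected {0..<n} (circulant_edges n k s)"
  shows "degree (circulant_poly k s) = s k - 1 \<and>
         of_nat (card (spanning_trees {0..<n} (circulant_edges n k s))) =
           (-1) ^ ((n - 1) * (s k - 1)) * of_nat n *
           (\<Prod>w\<in>#proots (circulant_poly k s). (poly (chebyshev_T n) w - 1) / (w - 1))"
proof
  define P where "P = circulant_poly k s"
  define R where "R w = (poly (chebyshev_T n) w - 1) / (w - 1)" for w :: complex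
  define \<tau> where "\<tau> = card (spanning_trees {0..<n} (circulant_edges n k s))"
  note leading = circulant_poly_leading[where s = s, OF assms(1-3), folded P_def]
  show "degree (circulant_poly k s) = s k - 1"
    using leading(1) by (simp add: P_def)
  have mono: "s i \<le> s j" if "i \<in> {1..k}" "j \<in> {1..k}" "i \<le> j" for i j
    using assms(3) that by (cases "i = j") (auto simp: strict_mono_on_def intro: less_imp_le)
  have jumps: "1 \<le> s j \<and> 2 * s j < n" if "j \<in> {1..k}" for j
    using mono[of 1 j] mono[of j k] that assms(1,2,4) by auto
  have n: "n > 0"
    using jumps[of 1] assms(1) by auto
  have "inj_on s {1..k}"
    using assms(3) by (rule strict_mono_on_imp_inj_on)
  from spanning_trees_circulant[of k s n, OF jumps this n]
  have "of_nat n * of_nat \<tau> = (\<Prod>j = 1..<n. 2 * (1 - node n j)) * (\<Prod>j = 1..<n. poly P (node n j))"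
    by (simp add: \<tau>_def circulant_eigenvalue_def P_def prod.distrib)
  also have "poly P 1 \<noteq> 0"
    unfolding P_def by (rule poly_circulant_poly_1_neq_0[of 1]) (use assms in auto)
  then have "(\<Prod>j = 1..<n. poly P (node n j))
      = lead_coeff P ^ (n - 1) * (\<Prod>w\<in>#proots P. (-1) ^ (n - 1) * R w / 2 ^ (n - 1))"
    unfolding R_def by (rule prod_poly_node[OF n])
  also have "\<dots> = (2 ^ (s k - 1)) ^ (n - 1) * ((-1) ^ (n - 1) / 2 ^ (n - 1)) ^ (s k - 1) * (\<Prod>w\<in>#proots P. R w)"
  proof -
    have "(\<Prod>w\<in>#proots P. (-1) ^ (n - 1) * R w / 2 ^ (n - 1))
        = (\<Prod>w\<in>#proots P. ((-1) ^ (n - 1) / 2 ^ (n - 1)) * R w)"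
      by (intro arg_cong[of _ _ prod_mset] image_mset_cong) simp
    also have "\<dots> = ((-1) ^ (n - 1) / 2 ^ (n - 1)) ^ size (proots P) * (\<Prod>w\<in>#proots P. R w)"
      unfolding prod_mset.distrib by simp
    finally show ?thesis
      unfolding leading(2) by (simp only: leading(1) size_proots_complex mult.assoc)
  qed
  also have "(2 ^ (s k - 1)) ^ (n - 1) * ((-1) ^ (n - 1) / 2 ^ (n - 1)) ^ (s k - 1)
      = ((-1) ^ ((n - 1) * (s k - 1)) :: complex)"
    by (simp add: power_divide mult.commute flip: power_mult)
  also have "(\<Prod>j = 1..<n. 2 * (1 - node n j)) = of_nat n ^ 2"
    by (rule prod_2_minus_2_node[OF n])
  finally have "complex_of_nat n * of_nat \<tau>
      = of_nat n * ((-1) ^ ((n - 1) * (s k - 1)) * of_nat n * (\<Prod>w\<in>#proots P. R w))"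
    by (simp add: power2_eq_square mult_ac)
  then show "of_nat (card (spanning_trees {0..<n} (circulant_edges n k s))) =
      (-1) ^ ((n - 1) * (s k - 1)) * of_nat n *
      (\<Prod>w\<in>#proots (circulant_poly k s). (poly (chebyshev_T n) w - 1) / (w - 1))"
    using n unfolding \<tau>_def P_def R_def by (subst (asm) mult_cancel_left) simp
qed

end
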